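(* Let $\lambda\in(0,1)$ and $d\in(0,1-\lambda)$. For any $\delta\in(1-\lambda-d,1)$ and $a\in[0,1]$ consider the map $f_{\delta,a}$. 1. For any $\rho\in(0,1)$, the rotation number of $f_{\delta,a}$ is $\rho$ if and only if $(\delta,a)\in\bigcup_{\alpha\in[0,1]}\mathcal{P}_{\rho,\alpha}$. 2. The set $\mathcal{I}:=\{(\delta,a)\in(1-\lambda-d,1)\times[0,1]:\text{the rotation number of }f_{\delta,a}\text{ is irrational}\}$ is a Lebesgue measurable set.
   Context: Notation: $\lfloor x\rfloor$ is the integer part and $\{x\}=x-\lfloor x\rfloor$ the fractional part of $x\in\mathbb{R}$. For $c\in\mathbb{R}$, $\theta_c(z)=0$ if $z<c$ and $\theta_c(z)=1$ if $z\ge c$. For $\delta,a\in[0,1]$, let $F:\mathbb{R}\to\mathbb{R}$, $F(x)=\lambda x+\delta+(1-\lambda)\lfloor x\rfloor+d\,\theta_a(\{x\})$, and let $f_{\delta,a}:[0,1)\to[0,1)$, $f_{\delta,a}(x)=F(x)\pmod1$. The rotation number of $f_{\delta,a}$ is $\lim_{n\to\infty}F^n(x)/n\pmod1$ (it exists and is independent of $x\in\mathbb{R}$). For $\rho,\alpha\in[0,1]$ define $$\delta(\rho,\alpha)=1-\lambda-d+\frac{1-\lambda}{\lambda}\sum_{k=1}^{\infty}\lambda^k\left((1-\lambda)\lfloor k\rho\rfloor+d\,\theta_{1-\alpha}(\{k\rho\})\right),$$ $$a(\delta,\rho,\alpha)=\frac{\delta}{1-\lambda}+\frac1\lambda\sum_{k=1}^{\infty}\lambda^k\left((1-\lambda)\lfloor\alpha-k\rho\rfloor+d\,\theta_\alpha(\{\alpha-k\rho\})\right)\quad\forall\delta\in[0,1].$$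 For $\rho\in(0,1)$, $\delta(\rho^-,\alpha)=\lim_{r\to\rho^-}\delta(r,\alpha)$ and $a(\delta,\rho^+,\alpha)=\lim_{r\to\rho^+}a(\delta,r,\alpha)$. For $\rho\in(0,1)$ and $\alpha\in[0,1]$, $$\mathcal{P}_{\rho,\alpha}=\{(\delta,a)\in\mathbb{R}^2:\delta\in[\delta(\rho^-,\alpha),\delta(\rho,\alpha)]\text{ and }a\in[a(\delta,\rho^+,\alpha),a(\delta,\rho,\alpha)]\}.$$ *)

theory Defs
  imports "HOL-Analysis.Analysis"
begin

definition theta :: "real \<Rightarrow> real \<Rightarrow> real" where
  "theta c z = (if z < c then 0 else 1)"

definition lift_F :: "real \<Rightarrow> real \<Rightarrow> real \<Rightarrow> real \<Rightarrow> real \<Rightarrow> real" where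
  "lift_F lam d \<delta> a x =
     lam * x + \<delta> + (1 - lam) * of_int \<lfloor>x\<rfloor> + d * theta a (frac x)"

text \<open>The circle map is meant on \<open>{0..<1}\<close>; reduction mod 1 is \<open>frac\<close>.\<close>

definition map_f :: "real \<Rightarrow> real \<Rightarrow> real \<Rightarrow> real \<Rightarrow> real \<Rightarrow> real" where
  "map_f lam d \<delta> a x = frac (lift_F lam d \<delta> a x)"

lemma map_f_in_unit: "map_f lam d \<delta> a x \<in> {0..<1}"
  by (simp add: map_f_def frac_lt_1)

lemma lift_F_decomp:
  "lift_F lam d \<delta> a x = lift_F lam d \<delta> a (frac x) + of_int \<lfloor>x\<rfloor>"
  by (simp add: lift_F_def frac_def algebra_simps)

lemma lift_F_lifts_map_f:
  "frac (lift_F lam d \<delta> a x) = map_f lam d \<delta> a (frac x)"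
  by (subst lift_F_decomp) (simp add: map_f_def frac_def)

text \<open>The limit of \<open>F\<^sup>n x / n\<close> is required to exist and to be the same for all real \<open>x\<close>;
  the rotation number is its representative in \<open>{0..<1}\<close>.\<close>

definition rotation_number :: "real \<Rightarrow> real \<Rightarrow> real \<Rightarrow> real \<Rightarrow> real" where
  "rotation_number lam d \<delta> a =
     (THE r. \<exists>L. (\<forall>x. (\<lambda>n. (lift_F lam d \<delta> a ^^ n) x / real n) \<longlonglongrightarrow> L) \<and> r = frac L)"

text \<open>The series start at exponent 1, hence the shift to \<open>Suc k\<close>.\<close>

definition delta_fun :: "real \<Rightarrow> real \<Rightarrow> real \<Rightarrow> real \<Rightarrow> real" where
  "delta_fun lam d \<rho> \<alpha> =
     1 - lam - d + (1 - lam) / lam *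
       (\<Sum>k. lam ^ Suc k * ((1 - lam) * of_int \<lfloor>real (Suc k) * \<rho>\<rfloor>
                            + d * theta (1 - \<alpha>) (frac (real (Suc k) * \<rho>))))"

definition a_fun :: "real \<Rightarrow> real \<Rightarrow> real \<Rightarrow> real \<Rightarrow> real \<Rightarrow> real" where
  "a_fun lam d \<delta> \<rho> \<alpha> =
     \<delta> / (1 - lam) + 1 / lam *
       (\<Sum>k. lam ^ Suc k * ((1 - lam) * of_int \<lfloor>\<alpha> - real (Suc k) * \<rho>\<rfloor>
                            + d * theta \<alpha> (frac (\<alpha> - real (Suc k) * \<rho>))))"

definition delta_left :: "real \<Rightarrow> real \<Rightarrow> real \<Rightarrow> real \<Rightarrow> real" where
  "delta_left lam d \<rho> \<alpha> = Lim (at_left \<rho>) (\<lambda>r. delta_fun lam d r \<alpha>)"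

definition a_right :: "real \<Rightarrow> real \<Rightarrow> real \<Rightarrow> real \<Rightarrow> real \<Rightarrow> real" where
  "a_right lam d \<delta> \<rho> \<alpha> = Lim (at_right \<rho>) (\<lambda>r. a_fun lam d \<delta> r \<alpha>)"

definition region_P :: "real \<Rightarrow> real \<Rightarrow> real \<Rightarrow> real \<Rightarrow> (real \<times> real) set" where
  "region_P lam d \<rho> \<alpha> =
     {(\<delta>, a). \<delta> \<in> {delta_left lam d \<rho> \<alpha> .. delta_fun lam d \<rho> \<alpha>} \<and>
              a \<in> {a_right lam d \<delta> \<rho> \<alpha> .. a_fun lam d \<delta> \<rho> \<alpha>}}"

end

theory Submission
  imports Defs
begin

text \<open>
  Since \<open>\<theta>\<^sub>c({x}) = \<lfloor>x + 1 - c\<rfloor> - \<lfloor>x\<rfloor>\<close>, the lift is \<open>F(x) = \<lambda>x + g\<^sub>a(x)\<close> with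
  \<open>g\<^sub>c(y) = \<delta> + (1 - \<lambda> - d) \<lfloor>y\<rfloor> + d \<lfloor>y + 1 - c\<rfloor>\<close>. Put
  \<open>\<phi>(y) = \<Sum>\<^sub>k \<lambda>\<^sup>k g\<^sub>\<alpha>(y - (k+1)\<rho>)\<close>, which solves \<open>\<phi>(y + \<rho>) = \<lambda>\<phi>(y) + g\<^sub>\<alpha>(y)\<close>, and let
  \<open>\<phi>'\<close> be its left-continuous version. Then \<open>(\<delta>, a)\<close> lies in the region for \<open>\<rho>, \<alpha>\<close>
  iff \<open>\<phi>'(0) \<le> 0 \<le> \<phi>(0)\<close> and \<open>\<phi>'(\<alpha>) \<le> a \<le> \<phi>(\<alpha>)\<close>.

  These inequalities give \<open>F(\<phi>(y)) \<ge> \<phi>(y + \<rho>)\<close>, and \<open>x < \<phi>'(y)\<close> implies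
  \<open>F(x) < \<phi>'(y + \<rho>)\<close>, so the rotation number is \<open>\<rho>\<close>. Conversely, let \<open>T\<close> be the lower
  adjoint of \<open>F\<close>, defined by \<open>T x \<le> t \<longleftrightarrow> x \<le> F t\<close>. If \<open>F\<close> has rotation number \<open>\<rho>\<close>, some
  \<open>\<alpha>\<close> makes the translates of the backward orbits \<open>T\<^sup>k 0\<close>, \<open>T\<^sup>k a\<close> compare with
  \<open>0\<close> and \<open>a\<close> as the translates of \<open>-k\<rho>\<close>, \<open>\<alpha> - k\<rho>\<close> compare with \<open>0\<close> and \<open>\<alpha>\<close>. Unrolling
  \<open>x \<le> F(T x)\<close> and \<open>F(T x -) \<le> x\<close> along these orbits yields the four inequalities,
  for rational and irrational \<open>\<rho>\<close> alike.
\<close>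

section \<open>Rotation numbers of monotone lifts of degree one\<close>

lemma shift_of_int:
  fixes f :: "real \<Rightarrow> real"
  assumes shift: "\<And>x. f (x + 1) = f x + c"
  shows "f (x + of_int m) = f x + c * of_int m"
proof (induction m rule: int_induct[where k = 0])
  case (step1 i)
  have "f (x + of_int (i + 1)) = f ((x + of_int i) + 1)" by (simp add: add.assoc)
  also have "\<dots> = f x + c * of_int (i + 1)"
    unfolding shift step1 by (simp add: distrib_left)
  finally show ?case .
next
  case (step2 i)
  have "f (x + of_int i) = f ((x + of_int (i - 1)) + 1)" by (simp add: add.assoc)
  also have "\<dots> = f (x + of_int (i - 1)) + c" by (rule shift)
  finally show ?case unfolding step2 by (simp add: right_diff_distrib)
qed simp

text \<open>With \<open>m\<close> the integer part of \<open>x - y\<close>, monotonicity and the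
  shift law trap both \<open>f x - f y\<close> and \<open>c * (x - y)\<close> between
  \<open>c * m\<close> and \<open>c * (m + 1)\<close>.\<close>

lemma mono_shift_dist:
  fixes f :: "real \<Rightarrow> real"
  assumes "mono f" and shift: "\<And>x. f (x + 1) = f x + c"
  shows "\<bar>f x - f y - c * (x - y)\<bar> \<le> c"
proof -
  have "f 0 \<le> f (0 + 1)" by (rule monoD[OF \<open>mono f\<close>]) simp
  then have c: "c \<ge> 0" unfolding shift by simp
  define m :: real where "m = of_int \<lfloor>x - y\<rfloor>"
  have m: "m \<le> x - y" "x - y \<le> m + 1" unfolding m_def by linarith+
  have "f (y + m) \<le> f x" "f x \<le> f ((y + m) + 1)"
    using m by (auto intro!: monoD[OF \<open>mono f\<close>])
  moreover have "f (y + m) = f y + c * m"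
    unfolding m_def by (rule shift_of_int[of f c]) (rule shift)
  moreover have "c * m \<le> c * (x - y)" "c * (x - y) \<le> c * (m + 1)"
    using m c by (auto intro!: mult_left_mono)
  ultimately show ?thesis
    by (simp only: shift distrib_left abs_le_iff) linarith
qed

locale degree_one_lift =
  fixes F :: "real \<Rightarrow> real"
  assumes mono: "mono F" and plus_one: "F (x + 1) = F x + 1"
begin

lemma plus_of_int: "F (x + of_int m) = F x + of_int m"
  using shift_of_int[of F 1, OF plus_one] by simp

lemma degree_one_lift_funpow: "degree_one_lift (F ^^ n)"
proof
  show "mono (F ^^ n)" by (intro monoI funpow_mono mono)
  show "(F ^^ n) (x + 1) = (F ^^ n) x + 1" for x by (induction n) (auto simp: plus_one)
qed

lemma funpow_plus_of_int: "(F ^^ n) (x + of_int m) = (F ^^ n) x + of_int m"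
  by (rule degree_one_lift.plus_of_int[OF degree_one_lift_funpow])

lemma funpow_dist: "\<bar>(F ^^ n) x - (F ^^ n) y - (x - y)\<bar> \<le> 1"
  using mono_shift_dist[of "F ^^ n" 1 x y] degree_one_lift_funpow[of n]
  by (auto simp: degree_one_lift_def)

text \<open>The translation number at base point 0, not yet reduced mod 1.\<close>

definition rot :: real where
  "rot = lim (\<lambda>n. (F ^^ n) 0 / real n)"

text \<open>The orbit of 0 is additive in time up to an error of 1, so \<open>u (m * n)\<close> is
  within \<open>n\<close> of \<open>n * u m\<close> and within \<open>m\<close> of
  \<open>m * u n\<close>. Comparing the two makes the quotients Cauchy.\<close>

lemma rot_tendsto_0: "(\<lambda>n. (F ^^ n) 0 / real n) \<longlonglongrightarrow> rot"
proof -
  define u where "u n = (F ^^ n) 0" for n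
  have add: "\<bar>u (m + n) - u m - u n\<bar> \<le> 1" for m n
    using funpow_dist[of m "u n" 0] by (simp add: u_def funpow_add)
  have mult: "\<bar>u (m * n) - real n * u m\<bar> \<le> real n" for m n
  proof (induction n)
    case (Suc n)
    have "\<bar>u (m * Suc n) - real (Suc n) * u m\<bar>
        \<le> \<bar>u (m + m * n) - u m - u (m * n)\<bar> + \<bar>u (m * n) - real n * u m\<bar>"
      by (simp add: algebra_simps)
    then show ?case using add[of m "m * n"] Suc by simp
  qed (simp add: u_def)
  have quot: "\<bar>u m / m - u n / n\<bar> \<le> 1 / m + 1 / n" if "m > 0" "n > 0" for m n :: nat
  proof -
    have "\<bar>real n * u m - real m * u n\<bar> \<le> real m + real n"
      using mult[of m n] mult[of n m] by (simp add: mult.commute[of n m])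
    moreover have "u m / m - u n / n = (real n * u m - real m * u n) / (real m * real n)"
      and "1 / real m + 1 / real n = (real m + real n) / (real m * real n)"
      using that by (auto simp: field_simps)
    ultimately show ?thesis
      using that by (simp add: abs_mult divide_right_mono)
  qed
  have "Cauchy (\<lambda>n. u n / real n)"
  proof (rule metric_CauchyI)
    fix e :: real assume "e > 0"
    then obtain M :: nat where M: "2 / e < M" using reals_Archimedean2 by blast
    moreover have "0 < 2 / e" using \<open>e > 0\<close> by simp
    ultimately have M0: "real M > 0" by linarith
    have "dist (u m / m) (u n / n) < e" if "m \<ge> M" "n \<ge> M" for m n
    proof -
      have "1 / m \<le> 1 / M" "1 / n \<le> 1 / M" using that M0 by (auto intro!: divide_left_mono)
      moreover have "2 / M < e" using M M0 \<open>e > 0\<close> by (simp add: field_simps)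
      ultimately show ?thesis
        using quot[of m n] that M0 by (simp add: dist_real_def)
    qed
    then show "\<exists>M. \<forall>m\<ge>M. \<forall>n\<ge>M. dist (u m / m) (u n / n) < e" by blast
  qed
  then show ?thesis
    unfolding rot_def u_def by (simp add: Cauchy_convergent_iff convergent_LIMSEQ_iff)
qed

lemma rot_tendsto: "(\<lambda>n. (F ^^ n) x / real n) \<longlonglongrightarrow> rot"
proof (rule Lim_transform[OF rot_tendsto_0])
  have "norm ((F ^^ n) x / n - (F ^^ n) 0 / n) \<le> (1 + \<bar>x\<bar>) * inverse (real n)" for n
    using funpow_dist[of n x 0]
    by (cases "n = 0") (auto simp: diff_divide_distrib[symmetric] field_simps)
  moreover have "(\<lambda>n. (1 + \<bar>x\<bar>) * inverse (real n)) \<longlonglongrightarrow> 0"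
    by (intro tendsto_mult_right_zero lim_inverse_n)
  ultimately show "(\<lambda>n. (F ^^ n) x / n - (F ^^ n) 0 / n) \<longlonglongrightarrow> 0"
    by (rule Lim_null_comparison[OF always_eventually, rule_format])
qed

lemma rot_tendsto_mult: "(\<lambda>n. (F ^^ (k * n)) x / real n) \<longlonglongrightarrow> real k * rot"
proof (cases "k = 0")
  case False
  have "(\<lambda>n. real k * ((F ^^ (n * k)) x / real (n * k))) \<longlonglongrightarrow> real k * rot"
    using False by (intro tendsto_mult tendsto_const LIMSEQ_linear[OF rot_tendsto]) auto
  with False show ?thesis by (simp add: mult.commute)
qed (use tendsto_mult_right_zero[OF lim_inverse_n, of x] in \<open>simp add: divide_inverse\<close>)

text \<open>The constant \<open>C\<close> disappears after division by \<open>n\<close>. Sampling at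
  multiples of \<open>k\<close> lets the bound come from one inequality for the \<open>k\<close>-th
  iterate.\<close>

lemma le_rot_mult:
  assumes "\<And>n. real n * r + C \<le> (F ^^ (k * n)) x"
  shows "r \<le> real k * rot"
proof -
  have "(\<lambda>n. r + C * inverse (real n)) \<longlonglongrightarrow> r + 0"
    by (intro tendsto_intros tendsto_mult_right_zero lim_inverse_n)
  moreover have "r + C * inverse (real n) \<le> (F ^^ (k * n)) x / real n" if "n > 0" for n
  proof -
    have eq: "r + C * inverse (real n) = (real n * r + C) / real n"
      using that by (simp add: field_simps)
    show ?thesis unfolding eq by (intro divide_right_mono assms) simp
  qed
  ultimately have "r + 0 \<le> real k * rot"
    by (intro tendsto_le[OF trivial_limit_sequentially rot_tendsto_mult])
      (auto intro: eventually_mono[OF eventually_gt_at_top[of 0]])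
  then show ?thesis by simp
qed

lemma rot_mult_le:
  assumes "\<And>n. (F ^^ (k * n)) x \<le> real n * r + C"
  shows "real k * rot \<le> r"
proof -
  have "(\<lambda>n. r + C * inverse (real n)) \<longlonglongrightarrow> r + 0"
    by (intro tendsto_intros tendsto_mult_right_zero lim_inverse_n)
  moreover have "(F ^^ (k * n)) x / real n \<le> r + C * inverse (real n)" if "n > 0" for n
  proof -
    have eq: "r + C * inverse (real n) = (real n * r + C) / real n"
      using that by (simp add: field_simps)
    show ?thesis unfolding eq by (intro divide_right_mono assms) simp
  qed
  ultimately have "real k * rot \<le> r + 0"
    by (intro tendsto_le[OF trivial_limit_sequentially _ rot_tendsto_mult])
      (auto intro: eventually_mono[OF eventually_gt_at_top[of 0]])
  then show ?thesis by simp
qed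

lemma rot_ge:
  assumes "x + of_int m \<le> (F ^^ k) x"
  shows "of_int m \<le> real k * rot"
proof (rule le_rot_mult)
  show "real n * of_int m + x \<le> (F ^^ (k * n)) x" for n
  proof (induction n)
    case (Suc n)
    have "x + of_int m * real n + of_int m \<le> (F ^^ k) (x + of_int (m * int n))"
      using assms unfolding funpow_plus_of_int by simp
    also have "\<dots> \<le> (F ^^ k) ((F ^^ (k * n)) x)"
      using Suc by (intro funpow_mono mono) (simp add: mult.commute)
    finally show ?case by (simp add: funpow_add algebra_simps)
  qed simp
qed

text \<open>Since \<open>F ^^ k\<close> may jump at \<open>x\<close>, only points left of
  \<open>x\<close> are constrained. The orbit starts at \<open>x - 1\<close>, and strictness keeps
  it in the range of the hypothesis.\<close>

lemma rot_le:
  assumes "\<And>s. s < x \<Longrightarrow> (F ^^ k) s < x + of_int m"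
  shows "real k * rot \<le> of_int m"
proof (rule rot_mult_le, rule less_imp_le)
  show "(F ^^ (k * n)) (x - 1) < real n * of_int m + x" for n
  proof (induction n)
    case (Suc n)
    have "(F ^^ k) ((F ^^ (k * n)) (x - 1) + of_int (- (m * int n))) < x + of_int m"
      using Suc by (intro assms) (simp add: mult.commute)
    then show ?case
      unfolding funpow_plus_of_int by (simp add: funpow_add algebra_simps)
  qed simp
qed

end

section \<open>The backward orbit\<close>

locale right_continuous_lift = degree_one_lift +
  assumes right_continuous: "continuous (at_right x) F"
begin

text \<open>The generalized inverse of \<open>F\<close>: a lift with jumps need not be invertible,
  so backward orbits are taken with this map.\<close>

definition adjoint :: "real \<Rightarrow> real" where
  "adjoint x = Inf {t. x \<le> F t}"

text \<open>The set is nonempty and bounded below because \<open>F\<close> moves integers by whole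
  steps. Right continuity is what makes the inequality hold at the infimum itself.\<close>

lemma adjoint_le_iff: "adjoint x \<le> t \<longleftrightarrow> x \<le> F t"
proof -
  let ?S = "{t. x \<le> F t}"
  define b where "b = x - F 0"
  have ceil: "F (of_int m) = F 0 + of_int m" for m
    using plus_of_int[of 0 m] by simp
  have "of_int \<lceil>b\<rceil> \<in> ?S"
    unfolding mem_Collect_eq ceil b_def by linarith
  then have ne: "?S \<noteq> {}" by blast
  have "of_int (\<lceil>b\<rceil> - 1) \<le> t" if "t \<in> ?S" for t
  proof (rule ccontr)
    assume "\<not> of_int (\<lceil>b\<rceil> - 1) \<le> t"
    then have "F t \<le> F (of_int (\<lceil>b\<rceil> - 1))"
      by (intro monoD[OF mono]) simp
    then have "b \<le> of_int (\<lceil>b\<rceil> - 1)"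
      using that unfolding ceil by (simp add: b_def)
    then show False by linarith
  qed
  then have bdd: "bdd_below ?S" by (rule bdd_belowI)
  show ?thesis
  proof
    assume "x \<le> F t"
    then show "adjoint x \<le> t" unfolding adjoint_def by (intro cInf_lower bdd) simp
  next
    assume le: "adjoint x \<le> t"
    have "x \<le> F s" if "s > t" for s
    proof -
      have "Inf ?S < s" using le that by (simp add: adjoint_def)
      then obtain r where "x \<le> F r" "r < s" using cInf_lessD[OF ne] by blast
      then show ?thesis using monoD[OF mono, of r s] by simp
    qed
    then have "eventually (\<lambda>s. x \<le> F s) (at_right t)"
      by (auto simp: eventually_at_right_field intro: exI[of _ "t + 1"])
    with right_continuous[of t] show "x \<le> F t"
      unfolding continuous_within by (intro tendsto_lowerbound) auto
  qed
qed

sublocale adjoint: degree_one_lift adjoint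
proof
  show "mono adjoint"
    by (rule monoI) (meson adjoint_le_iff order_refl order_trans)
  show "adjoint (x + 1) = adjoint x + 1" for x
  proof (rule antisym)
    have "x \<le> F (adjoint x)" using adjoint_le_iff by blast
    then show "adjoint (x + 1) \<le> adjoint x + 1"
      by (simp add: adjoint_le_iff plus_one)
    have "x + 1 \<le> F ((adjoint (x + 1) - 1) + 1)" unfolding diff_add_cancel adjoint_le_iff[symmetric] ..
    then have "adjoint x \<le> adjoint (x + 1) - 1"
      unfolding plus_one by (simp add: adjoint_le_iff)
    then show "adjoint x + 1 \<le> adjoint (x + 1)" by simp
  qed
qed

lemma funpow_adjoint_le_iff: "(adjoint ^^ k) x \<le> t \<longleftrightarrow> x \<le> (F ^^ k) t"
proof (induction k arbitrary: x)
  case (Suc k)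
  have "(adjoint ^^ Suc k) x \<le> t \<longleftrightarrow> (adjoint ^^ k) (adjoint x) \<le> t"
    by (simp only: funpow_Suc_right comp_apply)
  then show ?case by (simp add: Suc adjoint_le_iff)
qed simp

lemma funpow_adjoint_le_shift:
  assumes "(adjoint ^^ k) x \<le> x + of_int m"
  shows "- (real k * rot) \<le> of_int m"
proof -
  have "x \<le> (F ^^ k) x + of_int m"
    using assms by (simp add: funpow_adjoint_le_iff funpow_plus_of_int)
  then have "of_int (- m) \<le> real k * rot" by (intro rot_ge[of x]) simp
  then show ?thesis by simp
qed

text \<open>Negating the Galois connection yields a strict bound for points left of
  \<open>x\<close>, which is the form that \<open>rot_le\<close> takes.\<close>

lemma funpow_adjoint_ge_shift:
  assumes "x + of_int m \<le> (adjoint ^^ k) x"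
  shows "of_int m \<le> - (real k * rot)"
proof -
  have "(F ^^ k) s < x + of_int (- m)" if "s < x" for s
  proof -
    have "\<not> (adjoint ^^ k) x \<le> s + of_int m" using assms that by simp
    then show ?thesis by (simp add: funpow_adjoint_le_iff funpow_plus_of_int)
  qed
  then have "real k * rot \<le> of_int (- m)" by (rule rot_le)
  then show ?thesis by simp
qed

text \<open>The longer backward orbit continues the shorter one, so the comparison is a return of
  the shorter orbit's endpoint after \<open>k - j\<close> or \<open>j - k\<close> steps.\<close>

lemma funpow_adjoint_le:
  assumes "(adjoint ^^ k) x \<le> (adjoint ^^ j) x + of_int m"
  shows "- (real k * rot) \<le> - (real j * rot) + of_int m"
proof (cases "j \<le> k")
  case True
  then have "(adjoint ^^ k) x = (adjoint ^^ (k - j)) ((adjoint ^^ j) x)"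
    by (metis funpow_add comp_apply le_add_diff_inverse2)
  with assms have "- (real (k - j) * rot) \<le> of_int m"
    using funpow_adjoint_le_shift by metis
  with True show ?thesis by (simp add: of_nat_diff algebra_simps)
next
  case False
  then have "(adjoint ^^ j) x = (adjoint ^^ (j - k)) ((adjoint ^^ k) x)"
    by (metis funpow_add comp_apply le_add_diff_inverse2 nat_le_linear)
  with assms have "of_int (- m) \<le> - (real (j - k) * rot)"
    by (intro funpow_adjoint_ge_shift[of "(adjoint ^^ k) x"]) simp
  with False show ?thesis by (simp add: of_nat_diff algebra_simps)
qed

text \<open>Following \<open>x\<close> to \<open>y\<close> and then \<open>y\<close> back to
  \<open>x\<close>, each up to an integer, is a return of \<open>x\<close> after
  \<open>j + k\<close> steps.\<close>

lemma funpow_adjoint_le':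
  assumes "(adjoint ^^ k) x \<le> y + of_int m" and "(adjoint ^^ j) y \<le> x + of_int n"
  shows "- (real (j + k) * rot) \<le> of_int (m + n)"
proof (rule funpow_adjoint_le_shift)
  have "(adjoint ^^ (j + k)) x \<le> (adjoint ^^ j) (y + of_int m)"
    unfolding funpow_add comp_apply using assms(1) by (intro funpow_mono adjoint.mono)
  also have "\<dots> \<le> x + of_int (m + n)"
    unfolding adjoint.funpow_plus_of_int using assms(2) by simp
  finally show "(adjoint ^^ (j + k)) x \<le> x + of_int (m + n)" .
qed

lemma funpow_adjoint_ge':
  assumes "y + of_int m \<le> (adjoint ^^ k) x" and "x + of_int n \<le> (adjoint ^^ j) y"
  shows "of_int (m + n) \<le> - (real (j + k) * rot)"
proof (rule funpow_adjoint_ge_shift)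
  have "x + of_int (m + n) \<le> (adjoint ^^ j) (y + of_int m)"
    unfolding adjoint.funpow_plus_of_int using assms(2) by simp
  also have "\<dots> \<le> (adjoint ^^ (j + k)) x"
    unfolding funpow_add comp_apply using assms(1) by (intro funpow_mono adjoint.mono)
  finally show "x + of_int (m + n) \<le> (adjoint ^^ (j + k)) x" .
qed

text \<open>
  Each comparison is a lower or an upper bound for \<open>\<alpha>\<close>; composing two comparisons gives one
  within a single orbit, so every lower bound is at most every upper bound.
\<close>

lemma rotation_coordinate:
  obtains \<alpha> where
    "\<And>k m. (adjoint ^^ k) x \<le> y + of_int m \<Longrightarrow> - (real k * rot) \<le> \<alpha> + of_int m"
    "\<And>k m. y + of_int m \<le> (adjoint ^^ k) x \<Longrightarrow> \<alpha> + of_int m \<le> - (real k * rot)"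
    "\<And>k m. (adjoint ^^ k) y \<le> x + of_int m \<Longrightarrow> \<alpha> - (real k * rot) \<le> of_int m"
    "\<And>k m. x + of_int m \<le> (adjoint ^^ k) y \<Longrightarrow> of_int m \<le> \<alpha> - (real k * rot)"
proof -
  define L where "L =
    {- (real k * rot) - of_int m |k m. (adjoint ^^ k) x \<le> y + of_int m} \<union>
    {real k * rot + of_int m |k m. x + of_int m \<le> (adjoint ^^ k) y}"
  define U where "U =
    {- (real k * rot) - of_int m |k m. y + of_int m \<le> (adjoint ^^ k) x} \<union>
    {real k * rot + of_int m |k m. (adjoint ^^ k) y \<le> x + of_int m}"
  have LU: "l \<le> u" if "l \<in> L" "u \<in> U" for l u
  proof -
    \<comment> \<open>Cases 1 and 4 compare two points of one orbit; cases 2 and 3 compose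
      comparisons between the two orbits.\<close>
    have 1: "- (real k * rot) - of_int m \<le> - (real j * rot) - of_int n"
      if "(adjoint ^^ k) x \<le> y + of_int m" "y + of_int n \<le> (adjoint ^^ j) x" for k m j n
      using that funpow_adjoint_le[of k x j "m - n"] by simp
    have 2: "- (real k * rot) - of_int m \<le> real j * rot + of_int n"
      if "(adjoint ^^ k) x \<le> y + of_int m" "(adjoint ^^ j) y \<le> x + of_int n" for k m j n
      using funpow_adjoint_le'[OF that] by (simp add: algebra_simps)
    have 3: "real k * rot + of_int m \<le> - (real j * rot) - of_int n"
      if "x + of_int m \<le> (adjoint ^^ k) y" "y + of_int n \<le> (adjoint ^^ j) x" for k m j n
      using funpow_adjoint_ge'[OF that(2,1)] by (simp add: algebra_simps)
    have 4: "real k * rot + of_int m \<le> real j * rot + of_int n"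
      if "x + of_int m \<le> (adjoint ^^ k) y" "(adjoint ^^ j) y \<le> x + of_int n" for k m j n
      using that funpow_adjoint_le[of j y k "n - m"] by simp
    show ?thesis using that unfolding L_def U_def by (auto intro: 1 2 3 4)
  qed
  have ex_L: "\<exists>l. l \<in> L" and ex_U: "\<exists>u. u \<in> U"
  proof -
    \<comment> \<open>Without iterating, rounding \<open>x - y\<close> up and down gives a member of
      each set, so \<open>Sup L\<close> is a genuine supremum.\<close>
    have "(adjoint ^^ 0) x \<le> y + of_int \<lceil>x - y\<rceil>" "y + of_int \<lfloor>x - y\<rfloor> \<le> (adjoint ^^ 0) x"
      by simp_all linarith+
    then show "\<exists>l. l \<in> L" "\<exists>u. u \<in> U" unfolding L_def U_def by blast+
  qed
  have lower: "l \<le> Sup L" if "l \<in> L" for l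
    using that ex_U LU by (meson cSup_upper bdd_aboveI)
  have upper: "Sup L \<le> u" if "u \<in> U" for u
    using that ex_L LU by (intro cSup_least) auto
  show thesis
  proof (rule that)
    fix k m
    show "- (real k * rot) \<le> Sup L + of_int m" if "(adjoint ^^ k) x \<le> y + of_int m"
    proof -
      have "- (real k * rot) - of_int m \<in> L" unfolding L_def using that by blast
      from lower[OF this] show ?thesis by linarith
    qed
    show "Sup L + of_int m \<le> - (real k * rot)" if "y + of_int m \<le> (adjoint ^^ k) x"
    proof -
      have "- (real k * rot) - of_int m \<in> U" unfolding U_def using that by blast
      from upper[OF this] show ?thesis by linarith
    qed
    show "Sup L - (real k * rot) \<le> of_int m" if "(adjoint ^^ k) y \<le> x + of_int m"
    proof -
      have "real k * rot + of_int m \<in> U" unfolding U_def using that by blast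
      from upper[OF this] show ?thesis by linarith
    qed
    show "of_int m \<le> Sup L - (real k * rot)" if "x + of_int m \<le> (adjoint ^^ k) y"
    proof -
      have "real k * rot + of_int m \<in> L" unfolding L_def using that by blast
      from lower[OF this] show ?thesis by linarith
    qed
  qed
qed

end

section \<open>Invariant curves as series\<close>

text \<open>Obtained by unrolling
  \<open>\<phi>(y) = lam * \<phi>(y - \<rho>) + g (y - \<rho>)\<close> indefinitely.\<close>

definition backward_sum :: "real \<Rightarrow> (real \<Rightarrow> real) \<Rightarrow> real \<Rightarrow> real \<Rightarrow> real" where
  "backward_sum lam g \<rho> y = (\<Sum>k. lam ^ k * g (y - real (Suc k) * \<rho>))"

lemma summable_linear_power:
  fixes lam :: real
  assumes "\<bar>lam\<bar> < 1"
  shows "summable (\<lambda>k. lam ^ k * (A + B * real (Suc k)))"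
proof -
  have "summable (\<lambda>k. A * lam ^ k + B * (real (Suc k) * lam ^ k))"
    using assms geometric_deriv_sums[of lam]
    by (intro summable_add summable_mult summable_geometric) (auto simp: sums_iff)
  then show ?thesis by (simp add: algebra_simps)
qed

text \<open>Covers the right-continuous and the left-continuous step function at once. In both,
  \<open>c\<close> is \<open>1 - lam\<close>, which makes the curves increase by 1 over a
  unit.\<close>

locale forcing =
  fixes lam c :: real and g :: "real \<Rightarrow> real"
  assumes lam: "0 < lam" "lam < 1"
    and mono: "mono g" and plus_one: "g (x + 1) = g x + c"
begin

lemma c_nonneg: "c \<ge> 0"
proof -
  have "g 0 \<le> g (0 + 1)" by (rule monoD[OF mono]) simp
  then show ?thesis unfolding plus_one by simp
qed

lemma g_bound: "\<bar>g x\<bar> \<le> \<bar>g 0\<bar> + c + c * \<bar>x\<bar>"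
proof -
  have "\<bar>g x - g 0 - c * x\<bar> \<le> c"
    using mono_shift_dist[OF mono plus_one, of x 0] by simp
  moreover have "\<bar>c * x\<bar> = c * \<bar>x\<bar>" using c_nonneg by (simp add: abs_mult)
  ultimately show ?thesis by linarith
qed

text \<open>Uniformity over \<open>\<bar>\<rho>\<bar> \<le> R\<close> provides the majorant for
  limits in \<open>\<rho>\<close>.\<close>

lemma term_bound:
  assumes "\<bar>\<rho>\<bar> \<le> R"
  shows "\<bar>lam ^ k * g (y - real (Suc k) * \<rho>)\<bar>
    \<le> lam ^ k * ((\<bar>g 0\<bar> + c + c * \<bar>y\<bar>) + c * R * real (Suc k))"
proof -
  have "\<bar>y - real (Suc k) * \<rho>\<bar> \<le> \<bar>y\<bar> + \<bar>real (Suc k) * \<rho>\<bar>" by (rule abs_triangle_ineq4)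
  also have "\<bar>real (Suc k) * \<rho>\<bar> \<le> real (Suc k) * R"
    unfolding abs_mult using assms by (simp add: mult_left_mono)
  finally have "c * \<bar>y - real (Suc k) * \<rho>\<bar> \<le> c * (\<bar>y\<bar> + real (Suc k) * R)"
    using c_nonneg by (intro mult_left_mono) auto
  then have "\<bar>g (y - real (Suc k) * \<rho>)\<bar> \<le> (\<bar>g 0\<bar> + c + c * \<bar>y\<bar>) + c * R * real (Suc k)"
    using g_bound[of "y - real (Suc k) * \<rho>"] by (simp add: algebra_simps)
  then show ?thesis
    unfolding abs_mult using lam by (simp add: mult_left_mono)
qed

lemma summable_terms: "summable (\<lambda>k. lam ^ k * g (y - real (Suc k) * \<rho>))"
  by (rule summable_comparison_test'[OF summable_linear_power])
    (use lam term_bound[OF order_refl] in \<open>auto simp del: of_nat_Suc\<close>)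

lemma backward_sum_rec: "backward_sum lam g \<rho> y = lam * backward_sum lam g \<rho> (y - \<rho>) + g (y - \<rho>)"
proof -
  have "(\<Sum>k. lam ^ Suc k * g (y - real (Suc (Suc k)) * \<rho>)) =
      backward_sum lam g \<rho> y - g (y - \<rho>)"
    using suminf_split_head[OF summable_terms[of y \<rho>]] by (simp add: backward_sum_def)
  moreover have "(\<Sum>k. lam ^ Suc k * g (y - real (Suc (Suc k)) * \<rho>)) =
      lam * backward_sum lam g \<rho> (y - \<rho>)"
    unfolding backward_sum_def suminf_mult[OF summable_terms, symmetric]
    by (intro suminf_cong) (simp add: algebra_simps)
  ultimately show ?thesis by simp
qed

lemma mono_backward_sum: "mono (backward_sum lam g \<rho>)"
  unfolding backward_sum_def
  by (intro monoI suminf_le summable_terms mult_left_mono monoD[OF mono]) (use lam in auto)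

lemma backward_sum_plus_one:
  "backward_sum lam g \<rho> (y + 1) = backward_sum lam g \<rho> y + c / (1 - lam)"
proof -
  have "g (y + 1 - z) = g (y - z) + c" for z
    using plus_one[of "y - z"] by (simp add: algebra_simps)
  then have "backward_sum lam g \<rho> (y + 1) =
      (\<Sum>k. lam ^ k * g (y - real (Suc k) * \<rho>) + lam ^ k * c)"
    unfolding backward_sum_def by (simp only: distrib_left)
  also have "\<dots> = backward_sum lam g \<rho> y + (\<Sum>k. lam ^ k * c)"
    unfolding backward_sum_def
    by (rule suminf_add[symmetric, OF summable_terms])
      (use lam in \<open>auto intro!: summable_mult2 summable_geometric\<close>)
  also have "(\<Sum>k. lam ^ k * c) = c / (1 - lam)"
    using lam by (subst suminf_mult2[symmetric]) (auto simp: suminf_geometric summable_geometric)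
  finally show ?thesis .
qed

text \<open>Tannery's theorem. The limit has its own function \<open>h\<close> because one-sided
  limits in \<open>\<rho>\<close> exchange the right- and left-continuous steps.\<close>

lemma tendsto_backward_sum:
  assumes "F \<noteq> bot" and bounded: "eventually (\<lambda>r. \<bar>r\<bar> \<le> R) F"
    and limit: "\<And>k. ((\<lambda>r. g (y - real (Suc k) * r)) \<longlongrightarrow> h (y - real (Suc k) * \<rho>)) F"
  shows "((\<lambda>r. backward_sum lam g r y) \<longlongrightarrow> backward_sum lam h \<rho> y) F"
proof -
  let ?M = "\<lambda>k. lam ^ k * ((\<bar>g 0\<bar> + c + c * \<bar>y\<bar>) + c * R * real (Suc k))"
  have bnd: "eventually (\<lambda>(k, r). norm (lam ^ k * g (y - real (Suc k) * r)) \<le> ?M k) (at_top \<times>\<^sub>F F)"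
    unfolding eventually_prod_filter case_prod_conv
    by (rule exI[of _ "\<lambda>_. True"], rule exI[of _ "\<lambda>r. \<bar>r\<bar> \<le> R"])
      (use bounded term_bound in \<open>auto simp del: of_nat_Suc\<close>)
  have summ: "summable ?M" using lam by (intro summable_linear_power) simp
  have lim: "((\<lambda>r. lam ^ k * g (y - real (Suc k) * r)) \<longlongrightarrow> lam ^ k * h (y - real (Suc k) * \<rho>)) F"
    for k by (intro tendsto_mult tendsto_const limit)
  show ?thesis
    unfolding backward_sum_def using tannerys_theorem[OF lim bnd summ \<open>F \<noteq> bot\<close>] by blast
qed

text \<open>Unrolling the inequality \<open>n\<close> times leaves the remainder
  \<open>lam ^ n * z n\<close>, which vanishes. Here \<open>z\<close> will be a backward
  orbit.\<close>

lemma le_backward_sum: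
  fixes z :: "nat \<Rightarrow> real"
  assumes step: "\<And>k. z k \<le> lam * z (Suc k) + g (y - real (Suc k) * \<rho>)"
    and small: "(\<lambda>n. lam ^ n * z n) \<longlonglongrightarrow> 0"
  shows "z 0 \<le> backward_sum lam g \<rho> y"
proof -
  let ?t = "\<lambda>k. lam ^ k * g (y - real (Suc k) * \<rho>)"
  have le: "z 0 \<le> lam ^ n * z n + sum ?t {..<n}" for n
  proof (induction n)
    case (Suc n)
    have "lam ^ n * z n \<le> lam ^ n * (lam * z (Suc n) + g (y - real (Suc n) * \<rho>))"
      using lam by (intro mult_left_mono step) auto
    with Suc show ?case by (simp add: algebra_simps)
  qed simp
  have "(\<lambda>n. lam ^ n * z n + sum ?t {..<n}) \<longlonglongrightarrow> 0 + suminf ?t"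
    by (intro tendsto_add small summable_LIMSEQ summable_terms)
  with le show ?thesis
    unfolding backward_sum_def by (intro LIMSEQ_le_const) auto
qed

lemma backward_sum_le:
  fixes z :: "nat \<Rightarrow> real"
  assumes step: "\<And>k. lam * z (Suc k) + g (y - real (Suc k) * \<rho>) \<le> z k"
    and small: "(\<lambda>n. lam ^ n * z n) \<longlonglongrightarrow> 0"
  shows "backward_sum lam g \<rho> y \<le> z 0"
proof -
  let ?t = "\<lambda>k. lam ^ k * g (y - real (Suc k) * \<rho>)"
  have le: "lam ^ n * z n + sum ?t {..<n} \<le> z 0" for n
  proof (induction n)
    case (Suc n)
    have "lam ^ n * (lam * z (Suc n) + g (y - real (Suc n) * \<rho>)) \<le> lam ^ n * z n"
      using lam by (intro mult_left_mono step) auto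
    with Suc show ?case by (simp add: algebra_simps)
  qed simp
  have "(\<lambda>n. lam ^ n * z n + sum ?t {..<n}) \<longlonglongrightarrow> 0 + suminf ?t"
    by (intro tendsto_add small summable_LIMSEQ summable_terms)
  with le show ?thesis
    unfolding backward_sum_def by (intro LIMSEQ_le_const2) auto
qed

end

section \<open>Piecewise contractions\<close>

lemma eventually_floor_at_right: "eventually (\<lambda>t. \<lfloor>t + c\<rfloor> = \<lfloor>y + c\<rfloor>) (at_right (y::real))"
  unfolding eventually_at_right_field
  by (intro exI[of _ "of_int \<lfloor>y + c\<rfloor> + 1 - c"] conjI allI impI; (rule floor_unique)?; linarith)

lemma eventually_ceiling_at_right: "eventually (\<lambda>t. \<lceil>t + c\<rceil> = \<lfloor>y + c\<rfloor> + 1) (at_right (y::real))"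
  unfolding eventually_at_right_field
  by (intro exI[of _ "of_int \<lfloor>y + c\<rfloor> + 1 - c"] conjI allI impI; (rule ceiling_unique)?; linarith)

lemma eventually_floor_at_left: "eventually (\<lambda>t. \<lfloor>t + c\<rfloor> = \<lceil>y + c\<rceil> - 1) (at_left (y::real))"
  unfolding eventually_at_left_field
  by (intro exI[of _ "of_int \<lceil>y + c\<rceil> - 1 - c"] conjI allI impI; (rule floor_unique)?; linarith)

text \<open>Adding \<open>1 - c\<close> carries \<open>x\<close> to the next integer or beyond
  exactly when its fractional part has reached \<open>c\<close>, including at \<open>c = 0\<close>
  and \<open>c = 1\<close>.\<close>

lemma theta_frac:
  assumes "c \<in> {0..1}"
  shows "theta c (frac x) = of_int \<lfloor>x + (1 - c)\<rfloor> - of_int \<lfloor>x\<rfloor>"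
proof (cases "frac x < c")
  case True
  then have "\<lfloor>x + (1 - c)\<rfloor> = \<lfloor>x\<rfloor>"
    using assms by (intro floor_unique) (auto simp: frac_def, linarith)
  with True show ?thesis by (simp add: theta_def)
next
  case False
  then have "\<lfloor>x + (1 - c)\<rfloor> = \<lfloor>x\<rfloor> + 1"
    using assms frac_lt_1[of x] by (intro floor_unique) (auto simp: frac_def)
  with False show ?thesis by (simp add: theta_def)
qed

definition step_right :: "real \<Rightarrow> real \<Rightarrow> real \<Rightarrow> real \<Rightarrow> real \<Rightarrow> real" where
  "step_right lam d \<delta> c y =
     \<delta> + (1 - lam - d) * of_int \<lfloor>y\<rfloor> + d * of_int \<lfloor>y + (1 - c)\<rfloor>"

text \<open>The left limit of \<open>step_right\<close>: approaching from the left, the floor tends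
  to the ceiling minus 1.\<close>

definition step_left :: "real \<Rightarrow> real \<Rightarrow> real \<Rightarrow> real \<Rightarrow> real \<Rightarrow> real" where
  "step_left lam d \<delta> c y =
     \<delta> + (1 - lam - d) * of_int (\<lceil>y\<rceil> - 1) + d * of_int (\<lceil>y + (1 - c)\<rceil> - 1)"

lemma step_right_at_right:
  "(step_right lam d \<delta> c \<longlongrightarrow> step_right lam d \<delta> c y) (at_right y)"
  by (rule tendsto_eventually)
    (use eventually_conj[OF eventually_floor_at_right[of 0 y] eventually_floor_at_right[of "1 - c" y]]
      in \<open>auto elim!: eventually_mono simp: step_right_def\<close>)

lemma step_left_at_right:
  "(step_left lam d \<delta> c \<longlongrightarrow> step_right lam d \<delta> c y) (at_right y)"
  by (rule tendsto_eventually)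
    (use eventually_conj[OF eventually_ceiling_at_right[of 0 y] eventually_ceiling_at_right[of "1 - c" y]]
      in \<open>auto elim!: eventually_mono simp: step_right_def step_left_def\<close>)

lemma step_right_at_left:
  "(step_right lam d \<delta> c \<longlongrightarrow> step_left lam d \<delta> c y) (at_left y)"
  by (rule tendsto_eventually)
    (use eventually_conj[OF eventually_floor_at_left[of 0 y] eventually_floor_at_left[of "1 - c" y]]
      in \<open>auto elim!: eventually_mono simp: step_right_def step_left_def\<close>)

lemma lift_F_eq:
  assumes "a \<in> {0..1}"
  shows "lift_F lam d \<delta> a x = lam * x + step_right lam d \<delta> a x"
  unfolding lift_F_def theta_frac[OF assms] step_right_def by (simp add: algebra_simps)

locale contraction =
  fixes lam d :: real
  assumes lam_pos: "0 < lam" and d_pos: "0 < d" and sum_less: "lam + d < 1"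
begin

lemma lam_less_1: "lam < 1" using d_pos sum_less by simp

text \<open>The step sees a point only through its place among the integers and the integer
  translates of the parameter. Both directions of the equivalence supply the comparison in this
  form.\<close>

lemma step_right_le:
  fixes a \<alpha> y z :: real
  assumes "\<And>m::int. m \<le> z \<Longrightarrow> m \<le> y" "\<And>m::int. a + m \<le> z \<Longrightarrow> \<alpha> + m \<le> y"
  shows "step_right lam d \<delta> a z \<le> step_right lam d \<delta> \<alpha> y"
proof -
  have "\<lfloor>z\<rfloor> \<le> \<lfloor>y\<rfloor>" using assms(1)[of "\<lfloor>z\<rfloor>"] by linarith
  moreover have "\<lfloor>z + (1 - a)\<rfloor> \<le> \<lfloor>y + (1 - \<alpha>)\<rfloor>"
    using assms(2)[of "\<lfloor>z + (1 - a)\<rfloor> - 1"] by linarith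
  ultimately show ?thesis
    unfolding step_right_def using d_pos sum_less by (intro add_mono mult_left_mono) auto
qed

lemma step_left_le:
  fixes a \<alpha> y z :: real
  assumes "\<And>m::int. z \<le> m \<Longrightarrow> y \<le> m" "\<And>m::int. z \<le> a + m \<Longrightarrow> y \<le> \<alpha> + m"
  shows "step_left lam d \<delta> \<alpha> y \<le> step_left lam d \<delta> a z"
proof -
  have "\<lceil>y\<rceil> \<le> \<lceil>z\<rceil>" using assms(1)[of "\<lceil>z\<rceil>"] by linarith
  moreover have "\<lceil>y + (1 - \<alpha>)\<rceil> \<le> \<lceil>z + (1 - a)\<rceil>"
    using assms(2)[of "\<lceil>z + (1 - a)\<rceil> - 1"] by linarith
  ultimately show ?thesis
    unfolding step_left_def using d_pos sum_less by (intro add_mono mult_left_mono) auto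
qed

lemma step_right_le_step_left:
  assumes "x < z"
  shows "step_right lam d \<delta> c x \<le> step_left lam d \<delta> c z"
proof -
  have "\<lfloor>x\<rfloor> \<le> \<lceil>z\<rceil> - 1" "\<lfloor>x + (1 - c)\<rfloor> \<le> \<lceil>z + (1 - c)\<rceil> - 1" using assms by linarith+
  then show ?thesis
    unfolding step_right_def step_left_def using d_pos sum_less
    by (intro add_mono mult_left_mono) (auto simp del: of_int_diff)
qed

sublocale step_right: forcing lam "1 - lam" "step_right lam d \<delta> c" for \<delta> c
proof
  show "mono (step_right lam d \<delta> c)" by (intro monoI step_right_le) auto
  show "step_right lam d \<delta> c (x + 1) = step_right lam d \<delta> c x + (1 - lam)" for x
  proof -
    have "\<lfloor>x + 1 + (1 - c)\<rfloor> = \<lfloor>x + (1 - c)\<rfloor> + 1" by linarith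
    then show ?thesis by (simp add: step_right_def algebra_simps)
  qed
qed (use lam_pos lam_less_1 in auto)

sublocale step_left: forcing lam "1 - lam" "step_left lam d \<delta> c" for \<delta> c
proof
  show "mono (step_left lam d \<delta> c)" by (intro monoI step_left_le) auto
  show "step_left lam d \<delta> c (x + 1) = step_left lam d \<delta> c x + (1 - lam)" for x
  proof -
    have shift: "\<lceil>x + 1\<rceil> = \<lceil>x\<rceil> + 1" "\<lceil>x + 1 + (1 - c)\<rceil> = \<lceil>x + (1 - c)\<rceil> + 1" by linarith+
    show ?thesis unfolding step_left_def shift by (simp add: algebra_simps)
  qed
qed (use lam_pos lam_less_1 in auto)

lemma lift_F_right_continuous_lift:
  assumes "a \<in> {0..1}"
  shows "right_continuous_lift (lift_F lam d \<delta> a)"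
proof
  show "mono (lift_F lam d \<delta> a)"
    unfolding lift_F_eq[OF assms]
    by (intro monoI add_mono mult_left_mono monoD[OF step_right.mono]) (use lam_pos in auto)
  show "lift_F lam d \<delta> a (x + 1) = lift_F lam d \<delta> a x + 1" for x
    unfolding lift_F_eq[OF assms] step_right.plus_one by (simp add: algebra_simps)
  show "continuous (at_right x) (lift_F lam d \<delta> a)" for x
    unfolding continuous_within lift_F_eq[OF assms]
    by (intro tendsto_intros step_right_at_right)
qed

lemma rotation_number_eq:
  assumes "a \<in> {0..1}"
  shows "rotation_number lam d \<delta> a = frac (degree_one_lift.rot (lift_F lam d \<delta> a))"
proof -
  interpret right_continuous_lift "lift_F lam d \<delta> a"
    by (rule lift_F_right_continuous_lift[OF assms])
  show ?thesis
    unfolding rotation_number_def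
    by (rule the_equality) (use rot_tendsto LIMSEQ_unique in blast)+
qed

section \<open>The region expressed by the two invariant curves\<close>

text \<open>The summand \<open>\<delta> / (1 - lam)\<close> is a geometric series absorbed term by
  term, and \<open>1 / lam\<close> lowers the exponent by one.\<close>

lemma a_fun_eq:
  assumes "\<alpha> \<in> {0..1}"
  shows "a_fun lam d \<delta> \<rho> \<alpha> = backward_sum lam (step_right lam d \<delta> \<alpha>) \<rho> \<alpha>"
proof -
  define t where "t k = (1 - lam) * of_int \<lfloor>\<alpha> - real (Suc k) * \<rho>\<rfloor> +
    d * theta \<alpha> (frac (\<alpha> - real (Suc k) * \<rho>))" for k
  have t: "lam ^ k * t k =
      lam ^ k * step_right lam d \<delta> \<alpha> (\<alpha> - real (Suc k) * \<rho>) - \<delta> * lam ^ k" for k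
    unfolding t_def theta_frac[OF assms] step_right_def by (simp add: algebra_simps)
  have geom: "(\<lambda>k. \<delta> * lam ^ k) sums (\<delta> * (1 / (1 - lam)))"
    using lam_pos lam_less_1 by (intro sums_mult geometric_sums) auto
  have "(\<lambda>k. lam ^ k * t k) sums (backward_sum lam (step_right lam d \<delta> \<alpha>) \<rho> \<alpha> - \<delta> * (1 / (1 - lam)))"
    unfolding t backward_sum_def
    by (intro sums_diff geom summable_sums step_right.summable_terms)
  then have "(\<lambda>k. lam * (lam ^ k * t k)) sums
      (lam * (backward_sum lam (step_right lam d \<delta> \<alpha>) \<rho> \<alpha> - \<delta> * (1 / (1 - lam))))"
    by (rule sums_mult)
  then show ?thesis
    unfolding a_fun_def t_def[symmetric] using lam_pos by (simp add: sums_iff mult.assoc)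
qed

text \<open>Reflection \<open>u\<close> to \<open>-u\<close> turns floors into ceilings, hence
  \<open>step_left\<close>. On the right \<open>\<delta>\<close> cancels, so it may be chosen
  freely.\<close>

lemma delta_fun_eq:
  assumes "\<alpha> \<in> {0..1}"
  shows "delta_fun lam d \<rho> \<alpha> = \<delta> - (1 - lam) * backward_sum lam (step_left lam d \<delta> \<alpha>) \<rho> 0"
proof -
  let ?B = "backward_sum lam (step_left lam d \<delta> \<alpha>) \<rho> 0"
  define t where "t k = (1 - lam) * of_int \<lfloor>real (Suc k) * \<rho>\<rfloor> +
    d * theta (1 - \<alpha>) (frac (real (Suc k) * \<rho>))" for k
  have t: "lam ^ k * t k =
      (\<delta> - (1 - lam - d)) * lam ^ k - lam ^ k * step_left lam d \<delta> \<alpha> (0 - real (Suc k) * \<rho>)" for k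
  proof -
    define u where "u = real (Suc k) * \<rho>"
    have "\<lceil>0 - u\<rceil> = - \<lfloor>u\<rfloor>" "\<lceil>0 - u + (1 - \<alpha>)\<rceil> = 1 - \<lfloor>u + \<alpha>\<rfloor>" by linarith+
    moreover have "theta (1 - \<alpha>) (frac u) = of_int \<lfloor>u + \<alpha>\<rfloor> - of_int \<lfloor>u\<rfloor>"
      using theta_frac[of "1 - \<alpha>" u] assms by simp
    ultimately show ?thesis
      unfolding t_def u_def[symmetric] step_left_def by (simp only: of_int_diff) (simp add: algebra_simps)
  qed
  have geom: "(\<lambda>k. (\<delta> - (1 - lam - d)) * lam ^ k) sums ((\<delta> - (1 - lam - d)) * (1 / (1 - lam)))"
    using lam_pos lam_less_1 by (intro sums_mult geometric_sums) auto
  have "(\<lambda>k. lam ^ k * t k) sums ((\<delta> - (1 - lam - d)) * (1 / (1 - lam)) - ?B)"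
    unfolding t backward_sum_def
    by (intro sums_diff geom summable_sums step_left.summable_terms)
  then have "(\<lambda>k. lam * (lam ^ k * t k)) sums (lam * ((\<delta> - (1 - lam - d)) * (1 / (1 - lam)) - ?B))"
    by (rule sums_mult)
  then have "(\<Sum>k. lam ^ Suc k * t k) = lam * ((\<delta> - (1 - lam - d)) * (1 / (1 - lam)) - ?B)"
    by (simp add: sums_iff mult.assoc)
  then show ?thesis
    unfolding delta_fun_def t_def[symmetric] using lam_pos lam_less_1 by (simp add: field_simps)
qed

text \<open>As \<open>r\<close> decreases to \<open>\<rho>\<close>, the arguments
  \<open>\<alpha> - real (Suc k) * r\<close> increase to their limits, so left limits of the step
  appear.\<close>

lemma a_right_eq:
  assumes "\<alpha> \<in> {0..1}"
  shows "a_right lam d \<delta> \<rho> \<alpha> = backward_sum lam (step_left lam d \<delta> \<alpha>) \<rho> \<alpha>"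
  unfolding a_right_def a_fun_eq[OF assms]
proof (intro tendsto_Lim step_right.tendsto_backward_sum[of _ "\<bar>\<rho>\<bar> + 1"])
  show "eventually (\<lambda>r. \<bar>r\<bar> \<le> \<bar>\<rho>\<bar> + 1) (at_right \<rho>)"
    unfolding eventually_at_right_field by (rule exI[of _ "\<rho> + 1"]) auto
  fix k
  have "filterlim (\<lambda>r. \<alpha> - real (Suc k) * r) (at_left (\<alpha> - real (Suc k) * \<rho>)) (at_right \<rho>)"
    unfolding filterlim_at
    by (intro conjI tendsto_intros)
      (auto simp: eventually_at_right_field intro!: exI[of _ "\<rho> + 1"] simp del: of_nat_Suc)
  then show "((\<lambda>r. step_right lam d \<delta> \<alpha> (\<alpha> - real (Suc k) * r)) \<longlongrightarrow>
      step_left lam d \<delta> \<alpha> (\<alpha> - real (Suc k) * \<rho>)) (at_right \<rho>)"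
    by (rule filterlim_compose[OF step_right_at_left])
qed auto

lemma delta_left_eq:
  assumes "\<alpha> \<in> {0..1}"
  shows "delta_left lam d \<rho> \<alpha> = \<delta> - (1 - lam) * backward_sum lam (step_right lam d \<delta> \<alpha>) \<rho> 0"
  unfolding delta_left_def delta_fun_eq[OF assms, where \<delta> = \<delta>]
proof (intro tendsto_Lim tendsto_intros step_left.tendsto_backward_sum[of _ "\<bar>\<rho>\<bar> + 1"])
  show "eventually (\<lambda>r. \<bar>r\<bar> \<le> \<bar>\<rho>\<bar> + 1) (at_left \<rho>)"
    unfolding eventually_at_left_field by (rule exI[of _ "\<rho> - 1"]) auto
  fix k
  have "filterlim (\<lambda>r. 0 - real (Suc k) * r) (at_right (0 - real (Suc k) * \<rho>)) (at_left \<rho>)"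
    unfolding filterlim_at
    by (intro conjI tendsto_intros)
      (auto simp: eventually_at_left_field intro!: exI[of _ "\<rho> - 1"] simp del: of_nat_Suc)
  then show "((\<lambda>r. step_left lam d \<delta> \<alpha> (0 - real (Suc k) * r)) \<longlongrightarrow>
      step_right lam d \<delta> \<alpha> (0 - real (Suc k) * \<rho>)) (at_left \<rho>)"
    by (rule filterlim_compose[OF step_left_at_right])
qed auto

text \<open>Using the point's own \<open>\<delta>\<close> in the formulas for the endpoints, it
  cancels; dividing by \<open>1 - lam > 0\<close> leaves sign conditions at 0.\<close>

lemma region_P_iff:
  assumes "\<alpha> \<in> {0..1}"
  shows "(\<delta>, a) \<in> region_P lam d \<rho> \<alpha> \<longleftrightarrow>
    0 \<in> {backward_sum lam (step_left lam d \<delta> \<alpha>) \<rho> 0 .. backward_sum lam (step_right lam d \<delta> \<alpha>) \<rho> 0} \<and>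
    a \<in> {backward_sum lam (step_left lam d \<delta> \<alpha>) \<rho> \<alpha> .. backward_sum lam (step_right lam d \<delta> \<alpha>) \<rho> \<alpha>}"
  using lam_less_1
  by (auto simp: region_P_def a_fun_eq[OF assms] a_right_eq[OF assms]
      delta_fun_eq[OF assms, of \<rho> \<delta>] delta_left_eq[OF assms, of \<rho> \<delta>]
      zero_le_mult_iff mult_le_0_iff)

section \<open>Equivalence of membership in a region and rotation number\<close>

text \<open>No exact conjugacy to the rotation is needed: \<open>R\<close> bounds an orbit from
  below, \<open>L\<close> bounds one from above, and both curves differ from translations by at most
  1.\<close>

lemma rot_eq_of_region:
  assumes a: "a \<in> {0..1}"
    and zero: "0 \<in> {backward_sum lam (step_left lam d \<delta> \<alpha>) \<rho> 0 .. backward_sum lam (step_right lam d \<delta> \<alpha>) \<rho> 0}"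
    and a_in: "a \<in> {backward_sum lam (step_left lam d \<delta> \<alpha>) \<rho> \<alpha> .. backward_sum lam (step_right lam d \<delta> \<alpha>) \<rho> \<alpha>}"
  shows "degree_one_lift.rot (lift_F lam d \<delta> a) = \<rho>"
proof -
  let ?F = "lift_F lam d \<delta> a"
  define R where "R = backward_sum lam (step_right lam d \<delta> \<alpha>) \<rho>"
  define L where "L = backward_sum lam (step_left lam d \<delta> \<alpha>) \<rho>"
  interpret right_continuous_lift ?F by (rule lift_F_right_continuous_lift[OF a])
  have R: "mono R" "R (y + 1) = R y + 1" and L: "mono L" "L (y + 1) = L y + 1" for y
    using lam_less_1 step_right.mono_backward_sum step_left.mono_backward_sum
      step_right.backward_sum_plus_one step_left.backward_sum_plus_one
    by (simp_all add: R_def L_def)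
  have R_int: "R (y + of_int m) = R y + of_int m" and L_int: "L (y + of_int m) = L y + of_int m" for y m
    using shift_of_int[of R 1] shift_of_int[of L 1] R L by simp_all
  have R_rec: "R (y + \<rho>) \<le> ?F (R y)" for y
  proof -
    \<comment> \<open>The conditions at 0 and \<open>\<alpha>\<close> extend to all integer
      translates by \<open>R_int\<close>, so \<open>R\<close> keeps points on the correct side of
      the jumps.\<close>
    have "step_right lam d \<delta> \<alpha> y \<le> step_right lam d \<delta> a (R y)"
    proof (rule step_right_le)
      show "of_int m \<le> R y" if "of_int m \<le> y" for m
        using monoD[OF R(1) that] R_int[of 0 m] zero by (simp add: R_def)
      show "a + of_int m \<le> R y" if "\<alpha> + of_int m \<le> y" for m
        using monoD[OF R(1) that] R_int[of \<alpha> m] a_in by (simp add: R_def)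
    qed
    then show ?thesis
      unfolding lift_F_eq[OF a] R_def by (subst step_right.backward_sum_rec) simp
  qed
  \<comment> \<open>Strictness keeps \<open>x\<close> left of a possible jump of the lift at
    \<open>L y\<close>.\<close>
  have L_rec: "?F x < L (y + \<rho>)" if "x < L y" for x y
  proof -
    have "step_right lam d \<delta> a x \<le> step_left lam d \<delta> a (L y)"
      by (rule step_right_le_step_left[OF that])
    also have "\<dots> \<le> step_left lam d \<delta> \<alpha> y"
    proof (rule step_left_le)
      show "L y \<le> of_int m" if "y \<le> of_int m" for m
        using monoD[OF L(1) that] L_int[of 0 m] zero by (simp add: L_def)
      show "L y \<le> a + of_int m" if "y \<le> \<alpha> + of_int m" for m
        using monoD[OF L(1) that] L_int[of \<alpha> m] a_in by (simp add: L_def)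
    qed
    finally have "?F x < lam * L y + step_left lam d \<delta> \<alpha> y"
      unfolding lift_F_eq[OF a] using that lam_pos by (intro add_less_le_mono) auto
    also have "\<dots> = L (y + \<rho>)"
      unfolding L_def by (subst (2) step_left.backward_sum_rec) simp
    finally show ?thesis .
  qed
  have R_orbit: "R (real n * \<rho>) \<le> (?F ^^ n) (R 0)" for n
  proof (induction n)
    case (Suc n)
    have "R (real (Suc n) * \<rho>) = R (real n * \<rho> + \<rho>)" by (simp add: algebra_simps)
    also have "\<dots> \<le> ?F (R (real n * \<rho>))" by (rule R_rec)
    also have "\<dots> \<le> (?F ^^ Suc n) (R 0)" using monoD[OF mono Suc] by simp
    finally show ?case .
  qed simp
  have L_orbit: "(?F ^^ n) (L 0 - 1) < L (real n * \<rho>)" for n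
  proof (induction n)
    case (Suc n)
    then have "(?F ^^ Suc n) (L 0 - 1) < L (real n * \<rho> + \<rho>)" by (simp add: L_rec)
    then show ?case by (simp add: algebra_simps)
  qed simp
  have "real n * \<rho> + (R 0 - 1) \<le> (?F ^^ (1 * n)) (R 0)" for n
    using mono_shift_dist[of R 1 "real n * \<rho>" 0] R_orbit[of n] R by simp
  then have "\<rho> \<le> real 1 * rot" by (rule le_rot_mult)
  moreover have "(?F ^^ (1 * n)) (L 0 - 1) \<le> real n * \<rho> + (L 0 + 1)" for n
    using mono_shift_dist[of L 1 "real n * \<rho>" 0] L_orbit[of n] L by simp
  then have "real 1 * rot \<le> \<rho>" by (rule rot_mult_le)
  ultimately show ?thesis by simp
qed

lemma region_of_rot:
  fixes \<delta> a :: real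
  assumes a: "a \<in> {0..1}"
  defines "\<rho> \<equiv> degree_one_lift.rot (lift_F lam d \<delta> a)"
  obtains \<alpha> where "\<alpha> \<in> {0..1}"
    and "0 \<in> {backward_sum lam (step_left lam d \<delta> \<alpha>) \<rho> 0 .. backward_sum lam (step_right lam d \<delta> \<alpha>) \<rho> 0}"
    and "a \<in> {backward_sum lam (step_left lam d \<delta> \<alpha>) \<rho> \<alpha> .. backward_sum lam (step_right lam d \<delta> \<alpha>) \<rho> \<alpha>}"
proof -
  let ?F = "lift_F lam d \<delta> a"
  interpret right_continuous_lift ?F by (rule lift_F_right_continuous_lift[OF a])
  let ?T = "\<lambda>k. (adjoint ^^ k)"
  obtain \<alpha> where \<alpha>:
    "\<And>k m. ?T k 0 \<le> a + of_int m \<Longrightarrow> - (real k * \<rho>) \<le> \<alpha> + of_int m"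
    "\<And>k m. a + of_int m \<le> ?T k 0 \<Longrightarrow> \<alpha> + of_int m \<le> - (real k * \<rho>)"
    "\<And>k m. ?T k a \<le> 0 + of_int m \<Longrightarrow> \<alpha> - real k * \<rho> \<le> of_int m"
    "\<And>k m. 0 + of_int m \<le> ?T k a \<Longrightarrow> of_int m \<le> \<alpha> - real k * \<rho>"
    unfolding \<rho>_def using rotation_coordinate[of 0 a] by blast
  \<comment> \<open>Applied to the pairs \<open>(0, 0)\<close> and \<open>(a, \<alpha>)\<close>: it
    requires \<open>?T k x\<close> to lie among the translates of 0 and \<open>a\<close> as
    \<open>y - real k * \<rho>\<close> lies among those of 0 and \<open>\<alpha>\<close>.\<close>
  have orbit: "x \<in> {backward_sum lam (step_left lam d \<delta> \<alpha>) \<rho> y .. backward_sum lam (step_right lam d \<delta> \<alpha>) \<rho> y}"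
    if int: "\<And>k m. ?T k x \<le> of_int m \<Longrightarrow> y - real k * \<rho> \<le> of_int m"
      "\<And>k m. of_int m \<le> ?T k x \<Longrightarrow> of_int m \<le> y - real k * \<rho>"
    and shifted: "\<And>k m. ?T k x \<le> a + of_int m \<Longrightarrow> y - real k * \<rho> \<le> \<alpha> + of_int m"
      "\<And>k m. a + of_int m \<le> ?T k x \<Longrightarrow> \<alpha> + of_int m \<le> y - real k * \<rho>" for x y
  proof -
    define z where "z k = ?T k x" for k
    have z_Suc: "z (Suc k) = adjoint (z k)" for k by (simp add: z_def)
    \<comment> \<open>The integer comparisons keep \<open>z n\<close> within 1 of
      \<open>y - real n * \<rho>\<close>, so its growth is linear and the factor
      \<open>lam ^ n\<close> wins.\<close>
    have small: "(\<lambda>n. lam ^ n * z n) \<longlonglongrightarrow> 0"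
    proof (rule Lim_null_comparison)
      have "\<bar>z n\<bar> \<le> (\<bar>y\<bar> + 1) + \<bar>\<rho>\<bar> * real (Suc n)" for n
      proof -
        have "z n \<le> y - real n * \<rho> + 1" "y - real n * \<rho> - 1 \<le> z n"
          using int(1)[of n "\<lceil>z n\<rceil>"] int(2)[of "\<lfloor>z n\<rfloor>" n] unfolding z_def by linarith+
        moreover have "\<bar>real n * \<rho>\<bar> \<le> \<bar>\<rho>\<bar> * real (Suc n)"
          by (simp add: abs_mult algebra_simps)
        ultimately show ?thesis by linarith
      qed
      then show "eventually (\<lambda>n. norm (lam ^ n * z n) \<le> lam ^ n * ((\<bar>y\<bar> + 1) + \<bar>\<rho>\<bar> * real (Suc n))) sequentially"
        using lam_pos by (simp add: abs_mult mult_left_mono del: of_nat_Suc)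
      show "(\<lambda>n. lam ^ n * ((\<bar>y\<bar> + 1) + \<bar>\<rho>\<bar> * real (Suc n))) \<longlonglongrightarrow> 0"
        using lam_pos lam_less_1 by (intro summable_LIMSEQ_zero summable_linear_power) simp
    qed
    have up: "z k \<le> lam * z (Suc k) + step_right lam d \<delta> \<alpha> (y - real (Suc k) * \<rho>)" for k
    proof -
      have "z k \<le> ?F (z (Suc k))" using adjoint_le_iff[of "z k" "z (Suc k)"] z_Suc by simp
      moreover have "step_right lam d \<delta> a (z (Suc k)) \<le> step_right lam d \<delta> \<alpha> (y - real (Suc k) * \<rho>)"
        by (rule step_right_le) (use int(2) shifted(2) in \<open>auto simp: z_def simp del: funpow.simps of_nat_Suc\<close>)
      ultimately show ?thesis unfolding lift_F_eq[OF a] by simp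
    qed
    have down: "lam * z (Suc k) + step_left lam d \<delta> \<alpha> (y - real (Suc k) * \<rho>) \<le> z k" for k
    proof -
      \<comment> \<open>The bound holds strictly left of \<open>z (Suc k)\<close>; letting
        \<open>t\<close> tend to that point replaces \<open>step_right\<close> by its left
        limit.\<close>
      have "?F t \<le> z k" if "t < z (Suc k)" for t
        using that adjoint_le_iff[of "z k" t] by (simp add: z_Suc)
      then have "eventually (\<lambda>t. lam * t + step_right lam d \<delta> a t \<le> z k) (at_left (z (Suc k)))"
        unfolding eventually_at_left_field lift_F_eq[OF a] by (auto intro: exI[of _ "z (Suc k) - 1"])
      moreover have "((\<lambda>t. lam * t + step_right lam d \<delta> a t) \<longlongrightarrow>
          lam * z (Suc k) + step_left lam d \<delta> a (z (Suc k))) (at_left (z (Suc k)))"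
        by (intro tendsto_intros step_right_at_left)
      ultimately have "lam * z (Suc k) + step_left lam d \<delta> a (z (Suc k)) \<le> z k"
        by (intro tendsto_upperbound) auto
      moreover have "step_left lam d \<delta> \<alpha> (y - real (Suc k) * \<rho>) \<le> step_left lam d \<delta> a (z (Suc k))"
        by (rule step_left_le) (use int(1) shifted(1) in \<open>auto simp: z_def simp del: funpow.simps of_nat_Suc\<close>)
      ultimately show ?thesis by simp
    qed
    have "z 0 = x" by (simp add: z_def)
    with step_right.le_backward_sum[OF up small] step_left.backward_sum_le[OF down small]
    show ?thesis by simp
  qed
  \<comment> \<open>Comparisons of an orbit with translates of its own starting point do not involve
    \<open>\<alpha>\<close>; mixed ones come from the choice of \<open>\<alpha>\<close>.\<close>
  have T_le: "?T k x \<le> x + of_int m \<Longrightarrow> - (real k * \<rho>) \<le> of_int m"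
    and T_ge: "x + of_int m \<le> ?T k x \<Longrightarrow> of_int m \<le> - (real k * \<rho>)" for k x m
    unfolding \<rho>_def by (fact funpow_adjoint_le_shift funpow_adjoint_ge_shift)+
  show thesis
  proof (rule that)
    \<comment> \<open>At time 0, the bounds \<open>0 \<le> a\<close> and \<open>a \<le> 1\<close>
      are themselves comparisons of the two orbits.\<close>
    show "\<alpha> \<in> {0..1}" using \<alpha>(1)[of 0 0] \<alpha>(3)[of 0 1] a by simp
    show "0 \<in> {backward_sum lam (step_left lam d \<delta> \<alpha>) \<rho> 0 .. backward_sum lam (step_right lam d \<delta> \<alpha>) \<rho> 0}"
      by (rule orbit) (use T_le[of _ 0] T_ge[of 0] \<alpha>(1,2) in auto)
    show "a \<in> {backward_sum lam (step_left lam d \<delta> \<alpha>) \<rho> \<alpha> .. backward_sum lam (step_right lam d \<delta> \<alpha>) \<rho> \<alpha>}"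
      by (rule orbit) (use T_le[of _ a] T_ge[of a] \<alpha>(3,4) in \<open>fastforce+\<close>)
  qed
qed

section \<open>Reduction mod 1 and measurability\<close>

text \<open>The lift maps 0 to a nonnegative value and points below 1 to values below 2. Hence
  reduction mod 1 can only change the value 1.\<close>

lemma rot_bounds:
  assumes a: "a \<in> {0..1}" and \<delta>: "\<delta> \<in> {1 - lam - d<..<1}"
  shows "degree_one_lift.rot (lift_F lam d \<delta> a) \<in> {0..1}"
proof -
  let ?F = "lift_F lam d \<delta> a"
  interpret right_continuous_lift ?F by (rule lift_F_right_continuous_lift[OF a])
  have "0 + of_int 0 \<le> (?F ^^ 1) 0"
    using \<delta> d_pos sum_less by (simp add: lift_F_def theta_def)
  then have "0 \<le> rot" using rot_ge[of 0 0 1] by simp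
  moreover have "(?F ^^ 1) s < 1 + of_int 1" if "s < 1" for s
  proof -
    have "?F s \<le> lam * s + step_left lam d \<delta> a 1"
      using step_right_le_step_left[OF that] by (simp add: lift_F_eq[OF a])
    also have "lam * s < lam" using that lam_pos by simp
    also have "step_left lam d \<delta> a 1 \<le> \<delta> + d"
    proof -
      have "\<lceil>1 + (1 - a)\<rceil> \<le> 2" using a by (simp add: ceiling_le_iff)
      then show ?thesis using d_pos by (simp add: step_left_def)
    qed
    finally show ?thesis using \<delta> sum_less by simp
  qed
  then have "rot \<le> 1" using rot_le[of 1 1 1] by simp
  ultimately show ?thesis by simp
qed

text \<open>Induction on \<open>n\<close>: the lift is a Borel expression jointly in the parameters
  and the point, so the previous iterate may be substituted.\<close>

lemma funpow_lift_F_measurable [measurable]: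
  "(\<lambda>p. (lift_F lam d (fst p) (snd p) ^^ n) 0) \<in> borel_measurable (borel :: (real \<times> real) measure)"
proof (induction n)
  case (Suc n)
  define u where "u p = (lift_F lam d (fst p) (snd p) ^^ n) 0" for p :: "real \<times> real"
  have [measurable]: "u \<in> borel_measurable (borel \<Otimes>\<^sub>M borel)"
    using Suc unfolding u_def borel_prod .
  have "(\<lambda>p. lift_F lam d (fst p) (snd p) (u p)) \<in> borel_measurable (borel \<Otimes>\<^sub>M borel)"
    unfolding lift_F_def theta_def frac_def by measurable
  then show ?case by (simp add: u_def borel_prod)
qed simp

end

theorem corollary2p7:
  fixes lam d :: real
  assumes "lam \<in> {0<..<1}" and "d \<in> {0<..<1 - lam}"
  shows "(\<forall>\<delta>\<in>{1 - lam - d<..<1}. \<forall>a\<in>{0..1}. \<forall>\<rho>\<in>{0<..<1}.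
            rotation_number lam d \<delta> a = \<rho> \<longleftrightarrow> (\<delta>, a) \<in> (\<Union>\<alpha>\<in>{0..1}. region_P lam d \<rho> \<alpha>))
       \<and> {(\<delta>, a). (\<delta>, a) \<in> {1 - lam - d<..<1} \<times> {0..1} \<and> rotation_number lam d \<delta> a \<notin> \<rat>}
            \<in> sets (lebesgue :: (real \<times> real) measure)"
proof (intro conjI ballI)
  interpret contraction lam d using assms by unfold_locales auto
  fix \<delta> a \<rho> :: real
  assume \<delta>: "\<delta> \<in> {1 - lam - d<..<1}" and a: "a \<in> {0..1}" and \<rho>: "\<rho> \<in> {0<..<1}"
  let ?rot = "degree_one_lift.rot (lift_F lam d \<delta> a)"
  \<comment> \<open>The value 1 has fractional part 0, which lies outside the range of
    \<open>\<rho>\<close>.\<close>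
  have "frac ?rot = \<rho> \<longleftrightarrow> ?rot = \<rho>"
  proof
    assume frac: "frac ?rot = \<rho>"
    with \<rho> have "?rot \<noteq> 1" by auto
    with rot_bounds[OF a \<delta>] frac show "?rot = \<rho>" by (simp add: frac_eq)
  next
    assume "?rot = \<rho>"
    with \<rho> show "frac ?rot = \<rho>" by (simp add: frac_eq)
  qed
  moreover have "?rot = \<rho> \<longleftrightarrow> (\<exists>\<alpha>\<in>{0..1}. (\<delta>, a) \<in> region_P lam d \<rho> \<alpha>)"
  proof
    assume rot: "?rot = \<rho>"
    show "\<exists>\<alpha>\<in>{0..1}. (\<delta>, a) \<in> region_P lam d \<rho> \<alpha>"
      using region_of_rot[OF a, of \<delta>] unfolding rot by (metis region_P_iff)
  next
    assume "\<exists>\<alpha>\<in>{0..1}. (\<delta>, a) \<in> region_P lam d \<rho> \<alpha>"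
    then show "?rot = \<rho>" using rot_eq_of_region[OF a] by (auto simp only: region_P_iff)
  qed
  ultimately show "rotation_number lam d \<delta> a = \<rho> \<longleftrightarrow> (\<delta>, a) \<in> (\<Union>\<alpha>\<in>{0..1}. region_P lam d \<rho> \<alpha>)"
    by (simp add: rotation_number_eq[OF a])
next
  interpret contraction lam d using assms by unfold_locales auto
  \<comment> \<open>A limit of Borel functions on the whole plane; it is identified with the
    translation number only where \<open>a\<close> lies in the unit interval.\<close>
  define r where "r p = lim (\<lambda>n. (lift_F lam d (fst p) (snd p) ^^ n) 0 / real n)" for p
  have r: "rotation_number lam d \<delta> a = frac (r (\<delta>, a))" if "a \<in> {0..1}" for \<delta> a
  proof -
    interpret right_continuous_lift "lift_F lam d \<delta> a"
      by (rule lift_F_right_continuous_lift[OF that])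
    show ?thesis using rotation_number_eq[OF that] by (simp add: r_def rot_def)
  qed
  have [measurable]: "r \<in> borel_measurable borel" unfolding r_def by measurable
  have "\<rat> \<in> sets (borel :: real measure)" by (rule sets.countable[OF _ countable_rat]) simp
  then have "- \<rat> \<in> sets (borel :: real measure)" by (rule borel_comp)
  moreover have "(\<lambda>p. frac (r p)) \<in> borel_measurable borel" unfolding frac_def by measurable
  ultimately have "(\<lambda>p. frac (r p)) -` (- \<rat>) \<in> sets borel"
    using measurable_sets[of "\<lambda>p. frac (r p)" borel borel "- \<rat>"] by simp
  moreover have "{1 - lam - d<..<1} \<times> {0..1} \<in> sets (borel :: (real \<times> real) measure)"
    by (simp add: borel_Times)
  ultimately have "({1 - lam - d<..<1} \<times> {0..1}) \<inter> (\<lambda>p. frac (r p)) -` (- \<rat>) \<in> sets borel"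
    by (rule sets.Int[rotated])
  moreover have "({1 - lam - d<..<1} \<times> {0..1}) \<inter> (\<lambda>p. frac (r p)) -` (- \<rat>) =
      {(\<delta>, a). (\<delta>, a) \<in> {1 - lam - d<..<1} \<times> {0..1} \<and> rotation_number lam d \<delta> a \<notin> \<rat>}"
    by (auto simp: r)
  ultimately show "{(\<delta>, a). (\<delta>, a) \<in> {1 - lam - d<..<1} \<times> {0..1} \<and> rotation_number lam d \<delta> a \<notin> \<rat>}
      \<in> sets (lebesgue :: (real \<times> real) measure)"
    by simp
qed

end
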